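(* Let $\mathbf A$ be a Łukasiewicz near semiring and $\theta$ a congruence on $\mathbf A$. Then $[0]_\theta$ is an ideal of $\mathbf A$.
   Context: An $\iota$-near semiring is an algebra $\langle A,+,\cdot,{}^{\alpha},0,1\rangle$ of type $\langle 2,2,1,0,0\rangle$ such that $\langle A,+\rangle$ is a join semilattice with least element $0$ and greatest element $1$ (order $x\le y$ iff $x+y=y$), $x\cdot1=x=1\cdot x$, $(x+y)\cdot z=xz+yz$, $x0=0x=0$, $(x^{\alpha})^{\alpha}=x$, and $x\le y$ implies $y^{\alpha}\le x^{\alpha}$. A Łukasiewicz near semiring is an $\iota$-near semiring satisfying $(x y^{\alpha})^{\alpha} y^{\alpha}=(y x^{\alpha})^{\alpha} x^{\alpha}$. Juxtaposition $xy$ denotes $x\cdot y$. An ideal of a Łukasiewicz near semiring $\mathbf A$ is a set $I\subseteq A$ with $0\in I$ such that (I1) if $ab^{\alpha}\in I$ and $b\in I$ then $a\in I$; (I2) if $a^{\alpha}b\in I$ and $b^{\alpha}a\in I$ then $(ac)^{\alpha}(bc)\in I$ and $(ca)^{\alpha}(cb)\in I$ for every $c\in A$. *)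

theory Defs
  imports Main
begin

text \<open>Multiplication is required to be neither associative nor commutative, and only right
  distributivity \<open>(x + y) z = x z + y z\<close> is postulated.\<close>

locale iota_near_semiring =
  fixes A :: "'a set"
    and add :: "'a \<Rightarrow> 'a \<Rightarrow> 'a"  (infixl \<open>\<oplus>\<close> 65)
    and mult :: "'a \<Rightarrow> 'a \<Rightarrow> 'a"  (infixl \<open>\<odot>\<close> 70)
    and alpha :: "'a \<Rightarrow> 'a"
    and zero :: 'a  (\<open>\<zero>\<close>)
    and one :: 'a  (\<open>\<one>\<close>)
  assumes add_closed: "\<lbrakk>x \<in> A; y \<in> A\<rbrakk> \<Longrightarrow> x \<oplus> y \<in> A"
    and mult_closed: "\<lbrakk>x \<in> A; y \<in> A\<rbrakk> \<Longrightarrow> x \<odot> y \<in> A"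
    and alpha_closed: "x \<in> A \<Longrightarrow> alpha x \<in> A"
    and zero_closed: "\<zero> \<in> A"
    and one_closed: "\<one> \<in> A"
    and add_assoc: "\<lbrakk>x \<in> A; y \<in> A; z \<in> A\<rbrakk> \<Longrightarrow> (x \<oplus> y) \<oplus> z = x \<oplus> (y \<oplus> z)"
    and add_commute: "\<lbrakk>x \<in> A; y \<in> A\<rbrakk> \<Longrightarrow> x \<oplus> y = y \<oplus> x"
    and add_idem: "x \<in> A \<Longrightarrow> x \<oplus> x = x"
    and zero_least: "x \<in> A \<Longrightarrow> \<zero> \<oplus> x = x"
    and one_greatest: "x \<in> A \<Longrightarrow> x \<oplus> \<one> = \<one>"
    and mult_one_right: "x \<in> A \<Longrightarrow> x \<odot> \<one> = x"
    and mult_one_left: "x \<in> A \<Longrightarrow> \<one> \<odot> x = x"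
    and distrib_right: "\<lbrakk>x \<in> A; y \<in> A; z \<in> A\<rbrakk> \<Longrightarrow> (x \<oplus> y) \<odot> z = x \<odot> z \<oplus> y \<odot> z"
    and mult_zero_right: "x \<in> A \<Longrightarrow> x \<odot> \<zero> = \<zero>"
    and mult_zero_left: "x \<in> A \<Longrightarrow> \<zero> \<odot> x = \<zero>"
    and alpha_involution: "x \<in> A \<Longrightarrow> alpha (alpha x) = x"
    \<comment> \<open>\<open>x \<le> y\<close> implies \<open>alpha y \<le> alpha x\<close>, where \<open>x \<le> y\<close> means \<open>x \<oplus> y = y\<close>\<close>
    and alpha_antitone: "\<lbrakk>x \<in> A; y \<in> A; x \<oplus> y = y\<rbrakk> \<Longrightarrow> alpha y \<oplus> alpha x = alpha x"

locale lukasiewicz_near_semiring = iota_near_semiring +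
  assumes lukasiewicz:
    "\<lbrakk>x \<in> A; y \<in> A\<rbrakk> \<Longrightarrow>
      alpha (x \<odot> alpha y) \<odot> alpha y = alpha (y \<odot> alpha x) \<odot> alpha x"
begin

definition congruence :: "('a \<times> 'a) set \<Rightarrow> bool" where
  "congruence \<theta> \<longleftrightarrow>
    equiv A \<theta> \<and>
    (\<forall>a b c d. (a, b) \<in> \<theta> \<longrightarrow> (c, d) \<in> \<theta> \<longrightarrow> (a \<oplus> c, b \<oplus> d) \<in> \<theta>) \<and>
    (\<forall>a b c d. (a, b) \<in> \<theta> \<longrightarrow> (c, d) \<in> \<theta> \<longrightarrow> (a \<odot> c, b \<odot> d) \<in> \<theta>) \<and>
    (\<forall>a b. (a, b) \<in> \<theta> \<longrightarrow> (alpha a, alpha b) \<in> \<theta>)"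

definition ideal :: "'a set \<Rightarrow> bool" where
  "ideal I \<longleftrightarrow>
    I \<subseteq> A \<and>
    \<zero> \<in> I \<and>
    (\<forall>a\<in>A. \<forall>b\<in>A. a \<odot> alpha b \<in> I \<longrightarrow> b \<in> I \<longrightarrow> a \<in> I) \<and>
    (\<forall>a\<in>A. \<forall>b\<in>A. alpha a \<odot> b \<in> I \<longrightarrow> alpha b \<odot> a \<in> I \<longrightarrow>
      (\<forall>c\<in>A. alpha (a \<odot> c) \<odot> (b \<odot> c) \<in> I \<and> alpha (c \<odot> a) \<odot> (c \<odot> b) \<in> I))"

end

end

theory Submission
  imports Defs
begin

text \<open>Modulo \<open>\<theta>\<close>, the Lukasiewicz identity at \<open>x = alpha a\<close>, \<open>y = alpha b\<close> reads
  \<open>\<one> b = \<one> a\<close> as soon as \<open>alpha a b\<close> and \<open>alpha b a\<close> are identified with \<open>\<zero>\<close>. So the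
  hypothesis of (I2) forces \<open>(a, b) \<in> \<theta>\<close>, and (I2) follows because \<open>alpha x x = \<zero>\<close>, which is
  the same identity with one argument equal to \<open>\<one>\<close>.\<close>

context iota_near_semiring
begin

text \<open>As \<open>\<zero>\<close> is least, it lies below \<open>alpha \<one>\<close>;
  antitonicity and involution then put the greatest element \<open>\<one>\<close> below
  \<open>alpha \<zero>\<close>.\<close>

lemma alpha_zero: "alpha \<zero> = \<one>"
proof -
  have "alpha (alpha \<one>) \<oplus> alpha \<zero> = alpha \<zero>"
    by (rule alpha_antitone) (simp_all add: zero_closed one_closed alpha_closed zero_least)
  then have "\<one> \<oplus> alpha \<zero> = alpha \<zero>"
    by (simp add: alpha_involution one_closed)
  moreover have "\<one> \<oplus> alpha \<zero> = \<one>"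
    by (metis add_commute alpha_closed one_closed one_greatest zero_closed)
  ultimately show ?thesis
    by simp
qed

lemma alpha_one: "alpha \<one> = \<zero>"
  using alpha_involution[OF zero_closed] by (simp add: alpha_zero)

end

context lukasiewicz_near_semiring
begin

text \<open>With second argument \<open>\<one>\<close>, the left side of the identity ends in the
  factor \<open>alpha \<one> = \<zero>\<close> and vanishes, while the right side reduces to
  \<open>alpha x \<odot> x\<close>.\<close>

lemma alpha_mult_self:
  assumes "x \<in> A"
  shows "alpha x \<odot> x = \<zero>"
  using lukasiewicz[of "alpha x" \<one>] assms
  by (simp add: alpha_closed one_closed alpha_one mult_zero_right alpha_involution mult_one_left
      zero_closed)

lemma congruence_mult:
  "\<lbrakk>congruence \<theta>; (a, b) \<in> \<theta>; (c, d) \<in> \<theta>\<rbrakk> \<Longrightarrow> (a \<odot> c, b \<odot> d) \<in> \<theta>"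
  by (auto simp: congruence_def)

lemma congruence_alpha: "\<lbrakk>congruence \<theta>; (a, b) \<in> \<theta>\<rbrakk> \<Longrightarrow> (alpha a, alpha b) \<in> \<theta>"
  by (auto simp: congruence_def)

lemma congruence_refl: "\<lbrakk>congruence \<theta>; a \<in> A\<rbrakk> \<Longrightarrow> (a, a) \<in> \<theta>"
  by (auto simp: congruence_def equiv_def refl_on_def)

lemma congruence_sym: "\<lbrakk>congruence \<theta>; (a, b) \<in> \<theta>\<rbrakk> \<Longrightarrow> (b, a) \<in> \<theta>"
  by (auto simp: congruence_def equiv_def dest: symD)

lemma congruence_trans: "\<lbrakk>congruence \<theta>; (a, b) \<in> \<theta>; (b, c) \<in> \<theta>\<rbrakk> \<Longrightarrow> (a, c) \<in> \<theta>"
  by (auto simp: congruence_def equiv_def dest: transD)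

text \<open>If \<open>u\<close> is congruent to \<open>\<zero>\<close>, then \<open>alpha u\<close>
  is congruent to \<open>\<one>\<close> and so acts as a left unit modulo \<open>\<theta>\<close>.
  Multiplication need not commute, hence the separate right-handed version below.\<close>

lemma congruence_alpha_mult:
  assumes "congruence \<theta>" "(\<zero>, u) \<in> \<theta>" "x \<in> A"
  shows "(x, alpha u \<odot> x) \<in> \<theta>"
  using congruence_mult[OF assms(1) congruence_alpha[OF assms(1,2)] congruence_refl[OF assms(1,3)]]
  by (simp add: alpha_zero mult_one_left assms(3))

lemma congruence_mult_alpha:
  assumes "congruence \<theta>" "(\<zero>, u) \<in> \<theta>" "x \<in> A"
  shows "(x, x \<odot> alpha u) \<in> \<theta>"
  using congruence_mult[OF assms(1) congruence_refl[OF assms(1,3)] congruence_alpha[OF assms(1,2)]]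
  by (simp add: alpha_zero mult_one_right assms(3))

lemma congruence_if_differences_zero:
  assumes cong: "congruence \<theta>" and "a \<in> A" "b \<in> A"
    and "(\<zero>, alpha a \<odot> b) \<in> \<theta>" "(\<zero>, alpha b \<odot> a) \<in> \<theta>"
  shows "(a, b) \<in> \<theta>"
proof -
  have "alpha (alpha a \<odot> b) \<odot> b = alpha (alpha b \<odot> a) \<odot> a"
    using lukasiewicz[of "alpha a" "alpha b"] assms by (simp add: alpha_closed alpha_involution)
  then show ?thesis
    \<comment> \<open>The left side of the equation is congruent to \<open>b\<close>, the right side
      to \<open>a\<close>.\<close>
    using congruence_alpha_mult[OF cong assms(4,3)] congruence_alpha_mult[OF cong assms(5,2)]
    by (metis congruence_sym[OF cong] congruence_trans[OF cong])
qed

text \<open>Multiplying the pair on the left by \<open>alpha x\<close> turns its first component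
  into \<open>\<zero>\<close>. This leads from congruences back to the memberships that (I2) asks
  for.\<close>

lemma congruence_difference_zero:
  assumes "congruence \<theta>" "(x, y) \<in> \<theta>" "x \<in> A"
  shows "(\<zero>, alpha x \<odot> y) \<in> \<theta>"
  using congruence_mult[OF assms(1) congruence_refl[OF assms(1) alpha_closed[OF assms(3)]] assms(2)]
  by (simp add: alpha_mult_self assms(3))

lemma ideal_zero_class:
  assumes cong: "congruence \<theta>"
  shows "ideal (\<theta> `` {\<zero>})"
  unfolding ideal_def
proof (intro conjI ballI impI)
  show "\<theta> `` {\<zero>} \<subseteq> A"
    using cong by (auto simp: congruence_def dest: equiv_class_eq_iff)
  show "\<zero> \<in> \<theta> `` {\<zero>}"
    using congruence_refl[OF cong zero_closed] by simp
next
  fix a b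
  assume "a \<in> A" "a \<odot> alpha b \<in> \<theta> `` {\<zero>}" "b \<in> \<theta> `` {\<zero>}"
  \<comment> \<open>(I1): since \<open>b\<close> is congruent to \<open>\<zero>\<close>,
    \<open>a\<close> is congruent to \<open>a \<odot> alpha b\<close>, which is congruent to
    \<open>\<zero>\<close>.\<close>
  then show "a \<in> \<theta> `` {\<zero>}"
    using congruence_mult_alpha[OF cong] congruence_sym[OF cong] congruence_trans[OF cong]
    by blast
next
  fix a b c
  assume ab: "a \<in> A" "b \<in> A" and c: "c \<in> A"
    and "alpha a \<odot> b \<in> \<theta> `` {\<zero>}" "alpha b \<odot> a \<in> \<theta> `` {\<zero>}"
  then have "(a, b) \<in> \<theta>"
    using congruence_if_differences_zero[OF cong] by blast
  then have "(a \<odot> c, b \<odot> c) \<in> \<theta>" "(c \<odot> a, c \<odot> b) \<in> \<theta>"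
    using congruence_mult[OF cong] congruence_refl[OF cong c] by blast+
  then show "alpha (a \<odot> c) \<odot> (b \<odot> c) \<in> \<theta> `` {\<zero>}" "alpha (c \<odot> a) \<odot> (c \<odot> b) \<in> \<theta> `` {\<zero>}"
    using congruence_difference_zero[OF cong] ab c by (simp_all add: mult_closed)
qed

end

theorem theorem1:
  fixes A :: "'a set"
    and add mult :: "'a \<Rightarrow> 'a \<Rightarrow> 'a"
    and alpha :: "'a \<Rightarrow> 'a"
    and zero one :: 'a
    and \<theta> :: "('a \<times> 'a) set"
  assumes "lukasiewicz_near_semiring A add mult alpha zero one"
    and "lukasiewicz_near_semiring.congruence A add mult alpha \<theta>"
  shows "lukasiewicz_near_semiring.ideal A mult alpha zero (\<theta> `` {zero})"
  using assms by (rule lukasiewicz_near_semiring.ideal_zero_class)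

end
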